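(* Let $(\mathfrak{A},\theta)$ be a unital $\mathbb{Z}_2$-graded $C^*$-algebra and let $\omega$ be an even state on $\mathfrak{A}$. Then $\omega$ is an extreme point of the convex set $\mathcal{S}_+(\mathfrak{A})$ of all even states of $\mathfrak{A}$ if and only if the restriction $\omega|_{\mathfrak{A}_+}$ is a pure state of the even subalgebra $\mathfrak{A}_+$.
   Context: A $\mathbb{Z}_2$-graded $C^*$-algebra is a pair $(\mathfrak{A},\theta)$ with $\mathfrak{A}$ a $C^*$-algebra and $\theta$ a $*$-automorphism of $\mathfrak{A}$ with $\theta^2=\mathrm{id}$. The even subalgebra is $\mathfrak{A}_+=\{a\in\mathfrak{A}:\theta(a)=a\}$. A state $\omega$ on $\mathfrak{A}$ is even if $\omega\circ\theta=\omega$. *)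

theory Defs
  imports "HOL-Analysis.Analysis" "HOL-Library.Function_Algebras"
begin

text \<open>
  A complex unital Banach algebra with a conjugate-linear involution satisfying the
  C*-identity. The library only has real scalars, so the complex scalar multiplication is added
  and required to extend the real one. The superclass \<^class>\<open>real_normed_algebra_1\<close> provides
  \<open>norm 1 = 1\<close>, which holds in every nonzero unital C*-algebra; the zero algebra, which has
  no states, is thereby excluded.
\<close>

class unital_cstar_algebra = real_normed_algebra_1 + banach +
  fixes scaleC :: "complex \<Rightarrow> 'a \<Rightarrow> 'a" (infixr \<open>*\<^sub>C\<close> 75)
    and star :: "'a \<Rightarrow> 'a"
  assumes scaleC_add_right: "c *\<^sub>C (x + y) = c *\<^sub>C x + c *\<^sub>C y"
    and scaleC_add_left: "(c + d) *\<^sub>C x = c *\<^sub>C x + d *\<^sub>C x"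
    and scaleC_scaleC: "c *\<^sub>C d *\<^sub>C x = (c * d) *\<^sub>C x"
    and scaleC_of_real: "complex_of_real r *\<^sub>C x = r *\<^sub>R x"
    and mult_scaleC_left: "(c *\<^sub>C x) * y = c *\<^sub>C (x * y)"
    and mult_scaleC_right: "x * (c *\<^sub>C y) = c *\<^sub>C (x * y)"
    and norm_scaleC: "norm (c *\<^sub>C x) = cmod c * norm x"
    and star_add: "star (x + y) = star x + star y"
    and star_scaleC: "star (c *\<^sub>C x) = cnj c *\<^sub>C star x"
    and star_mult: "star (x * y) = star y * star x"
    and star_star: "star (star x) = x"
    and cstar_identity: "norm (star x * x) = (norm x)\<^sup>2"

definition star_automorphism :: "('a::unital_cstar_algebra \<Rightarrow> 'a) \<Rightarrow> bool" where
  "star_automorphism \<theta> \<longleftrightarrow>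
     bij \<theta> \<and>
     (\<forall>x y. \<theta> (x + y) = \<theta> x + \<theta> y) \<and>
     (\<forall>c x. \<theta> (c *\<^sub>C x) = c *\<^sub>C \<theta> x) \<and>
     (\<forall>x y. \<theta> (x * y) = \<theta> x * \<theta> y) \<and>
     (\<forall>x. \<theta> (star x) = star (\<theta> x))"

definition Z2_grading :: "('a::unital_cstar_algebra \<Rightarrow> 'a) \<Rightarrow> bool" where
  "Z2_grading \<theta> \<longleftrightarrow> star_automorphism \<theta> \<and> \<theta> \<circ> \<theta> = id"

definition even_subalgebra :: "('a::unital_cstar_algebra \<Rightarrow> 'a) \<Rightarrow> 'a set" where
  "even_subalgebra \<theta> = {a. \<theta> a = a}"

lemma even_subalgebra_unital_star_subalgebra:
  assumes "Z2_grading \<theta>"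
  shows "1 \<in> even_subalgebra \<theta>"
    and "x \<in> even_subalgebra \<theta> \<Longrightarrow> y \<in> even_subalgebra \<theta> \<Longrightarrow> x + y \<in> even_subalgebra \<theta>"
    and "x \<in> even_subalgebra \<theta> \<Longrightarrow> c *\<^sub>C x \<in> even_subalgebra \<theta>"
    and "x \<in> even_subalgebra \<theta> \<Longrightarrow> y \<in> even_subalgebra \<theta> \<Longrightarrow> x * y \<in> even_subalgebra \<theta>"
    and "x \<in> even_subalgebra \<theta> \<Longrightarrow> star x \<in> even_subalgebra \<theta>"
proof -
  have sa: "bij \<theta>" "\<And>x y. \<theta> (x * y) = \<theta> x * \<theta> y"
    using assms by (auto simp: Z2_grading_def star_automorphism_def)
  obtain u where u: "\<theta> u = 1"
    using sa(1) by (metis bij_pointE)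
  have "\<theta> 1 = 1"
    using sa(2)[of u 1] u by simp
  then show "1 \<in> even_subalgebra \<theta>"
    by (simp add: even_subalgebra_def)
qed (use assms in \<open>auto simp: even_subalgebra_def Z2_grading_def star_automorphism_def\<close>)

text \<open>
  Pointwise real vector space structure on functions, so that the library's \<^const>\<open>convex\<close> and
  \<^const>\<open>extreme_point_of\<close> apply to sets of functionals.
\<close>

instantiation "fun" :: (type, real_vector) real_vector
begin

definition scaleR_fun_def: "r *\<^sub>R f = (\<lambda>x. r *\<^sub>R f x)"

instance
  by standard (simp_all add: scaleR_fun_def fun_eq_iff scaleR_add_right scaleR_add_left)

end

text \<open>
  States of a unital *-subalgebra \<open>B\<close> (the whole algebra being \<open>B = UNIV\<close>): linear functionals
  that are positive, with positivity tested on the elements \<open>b* b\<close> for \<open>b\<close> in \<open>B\<close> itself, and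
  normalised. A functional on \<open>B\<close> is represented by the function that is \<open>0\<close> outside \<open>B\<close>, so
  that functionals on \<open>B\<close> are equal iff they agree on \<open>B\<close> and convex combinations are pointwise.
\<close>

definition states_on :: "'a::unital_cstar_algebra set \<Rightarrow> ('a \<Rightarrow> complex) set" where
  "states_on B = {\<phi>.
     (\<forall>x\<in>B. \<forall>y\<in>B. \<phi> (x + y) = \<phi> x + \<phi> y) \<and>
     (\<forall>c. \<forall>x\<in>B. \<phi> (c *\<^sub>C x) = c * \<phi> x) \<and>
     (\<forall>b\<in>B. \<phi> (star b * b) \<in> \<real>\<^sub>\<ge>\<^sub>0) \<and>
     \<phi> 1 = 1 \<and>
     (\<forall>x. x \<notin> B \<longrightarrow> \<phi> x = 0)}"

definition restrict_functional ::
    "('a::unital_cstar_algebra \<Rightarrow> complex) \<Rightarrow> 'a set \<Rightarrow> 'a \<Rightarrow> complex" where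
  "restrict_functional \<phi> B = (\<lambda>x. if x \<in> B then \<phi> x else 0)"

definition pure_state_on :: "'a::unital_cstar_algebra set \<Rightarrow> ('a \<Rightarrow> complex) \<Rightarrow> bool" where
  "pure_state_on B \<phi> \<longleftrightarrow> \<phi> extreme_point_of states_on B"

definition even_states :: "('a::unital_cstar_algebra \<Rightarrow> 'a) \<Rightarrow> ('a \<Rightarrow> complex) set" where
  "even_states \<theta> = {\<omega> \<in> states_on UNIV. \<omega> \<circ> \<theta> = \<omega>}"

lemma convex_states_on: "convex (states_on B)"
  unfolding convex_def states_on_def
  by (auto simp: scaleR_fun_def algebra_simps scaleR_conv_of_real complex_nonneg_Reals_iff
      simp flip: of_real_add)

lemma convex_even_states: "convex (even_states \<theta>)"
proof -
  have "convex {\<omega> :: 'a \<Rightarrow> complex. \<omega> \<circ> \<theta> = \<omega>}"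
    by (auto simp: convex_def scaleR_fun_def fun_eq_iff)
  moreover have "even_states \<theta> = states_on UNIV \<inter> {\<omega>. \<omega> \<circ> \<theta> = \<omega>}"
    by (auto simp: even_states_def)
  ultimately show ?thesis
    by (simp add: convex_Int convex_states_on)
qed

end

theory Submission
  imports Defs
begin

text \<open>
  With \<open>E x = (x + \<theta> x) / 2\<close>, restriction to the even subalgebra and \<open>\<phi> \<mapsto> \<phi> \<circ> E\<close> are mutually
  inverse affine maps between the even states and the states of the even subalgebra, hence match
  extreme points. The only real issue is that \<open>\<phi> \<circ> E\<close> is positive: \<open>E (b\<^sup>* b) = c\<^sup>* c + d\<^sup>* d\<close>
  with \<open>c\<close> the even and \<open>d\<close> the odd part of \<open>b\<close>, and one needs an even \<open>s\<close> with
  \<open>d\<^sup>* d = s\<^sup>* s\<close>. It is the square root of \<open>d\<^sup>* d\<close>, which exists since \<open>d\<^sup>* d\<close> is positive and is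
  fixed by \<open>\<theta>\<close> since it is a norm limit of polynomials in \<open>d\<^sup>* d\<close>. Square roots come from the
  binomial series of \<open>(1 - x)\<^bsup>1/2\<^esup>\<close> on the closed unit ball, so that no spectral theory is needed;
  positivity of a self-adjoint \<open>h\<close> is expressed by \<open>norm (r - h) \<le> r\<close> for some \<open>r\<close>.
\<close>

subsection \<open>The involution\<close>

lemma scaleC_minus_right: "c *\<^sub>C (- x) = - (c *\<^sub>C (x::'a::unital_cstar_algebra))"
proof -
  have "c *\<^sub>C (0::'a) = 0"
    using scaleC_add_right[of c 0 "0::'a"] by simp
  then show ?thesis
    using scaleC_add_right[of c x "- x"] by (simp add: eq_neg_iff_add_eq_0 add.commute)
qed

lemma scaleC_diff_right: "c *\<^sub>C (x - y) = c *\<^sub>C x - c *\<^sub>C (y::'a::unital_cstar_algebra)"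
  using scaleC_add_right[of c x "- y"] by (simp add: scaleC_minus_right)

lemma scaleC_minus_left: "(- c) *\<^sub>C x = - (c *\<^sub>C (x::'a::unital_cstar_algebra))"
proof -
  have "0 *\<^sub>C x = 0"
    using scaleC_of_real[of 0 x] by simp
  then show ?thesis
    using scaleC_add_left[of c "- c" x] by (simp add: eq_neg_iff_add_eq_0 add.commute)
qed

lemma scaleC_one: "1 *\<^sub>C x = (x::'a::unital_cstar_algebra)"
  using scaleC_of_real[of 1 x] by simp

lemma star_scaleR: "star (r *\<^sub>R x) = r *\<^sub>R star (x::'a::unital_cstar_algebra)"
  using star_scaleC[of "complex_of_real r" x] by (simp add: scaleC_of_real)

lemma star_zero [simp]: "star (0::'a::unital_cstar_algebra) = 0"
  using star_scaleR[of 0 "0::'a"] by simp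

lemma star_minus: "star (- x) = - star (x::'a::unital_cstar_algebra)"
  using star_scaleR[of "-1" x] by simp

lemma star_diff: "star (x - y) = star x - star (y::'a::unital_cstar_algebra)"
  using star_add[of x "- y"] by (simp add: star_minus)

lemma star_one [simp]: "star (1::'a::unital_cstar_algebra) = 1"
  using star_mult[of "star 1" "1::'a"] by (simp add: star_star)

lemma star_power: "star (x ^ n) = star (x::'a::unital_cstar_algebra) ^ n"
  by (induction n) (simp_all add: star_mult power_commutes)

text \<open>The C*-identity and submultiplicativity give \<open>norm y \<le> norm (star y)\<close>;
  applied to \<open>star y\<close>, the same inequality gives the converse.\<close>

lemma norm_star: "norm (star x) = norm (x::'a::unital_cstar_algebra)"
proof -
  have le: "norm y \<le> norm (star y)" for y :: 'a
  proof (cases "y = 0")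
    case False
    have "norm y * norm y \<le> norm (star y) * norm y"
      using cstar_identity[of y] norm_mult_ineq[of "star y" y] by (simp add: power2_eq_square)
    then show ?thesis
      using False by simp
  qed simp
  show ?thesis
    using le[of x] le[of "star x"] by (simp add: star_star)
qed

lemma bounded_linear_star: "bounded_linear (star :: 'a::unital_cstar_algebra \<Rightarrow> 'a)"
  by (rule bounded_linear_intro[where K = 1]) (simp_all add: star_add star_scaleR norm_star)

lemma norm_square_selfadjoint:
  fixes x :: "'a::unital_cstar_algebra"
  assumes "star x = x"
  shows "norm (x * x) = (norm x)\<^sup>2"
  using cstar_identity[of x] assms by simp

text \<open>Each use of the C*-identity doubles the exponent, hence the powers of two. This lets the
  growth of the norms of powers control the norm itself.\<close>

lemma norm_power_two_power_selfadjoint: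
  fixes x :: "'a::unital_cstar_algebra"
  assumes "star x = x"
  shows "norm (x ^ (2 ^ k)) = norm x ^ (2 ^ k)"
proof (induction k)
  case (Suc k)
  have "x ^ (2 ^ Suc k) = x ^ (2 ^ k) * x ^ (2 ^ k)"
    by (simp flip: power_add add: mult_2)
  then have "norm (x ^ (2 ^ Suc k)) = (norm (x ^ (2 ^ k)))\<^sup>2"
    using norm_square_selfadjoint[of "x ^ (2 ^ k)"] assms by (simp add: star_power)
  also have "\<dots> = norm x ^ (2 ^ Suc k)"
    by (simp add: Suc power_mult[symmetric] mult.commute)
  finally show ?case .
qed simp

lemma norm_unitary:
  fixes u :: "'a::unital_cstar_algebra"
  assumes "star u * u = 1"
  shows "norm u = 1"
  using cstar_identity[of u] assms norm_ge_zero[of u] by (simp add: power2_eq_1_iff)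

subsection \<open>Square roots by the binomial series\<close>

text \<open>The Taylor coefficients of \<open>(1 - x)^(1/2)\<close> at 0; the sign comes from
  substituting \<open>- x\<close> into the binomial series.\<close>

definition sqrt_coeff :: "nat \<Rightarrow> real" where
  "sqrt_coeff n = (-1) ^ n * ((1/2) gchoose n)"

lemma sqrt_coeff_0 [simp]: "sqrt_coeff 0 = 1"
  by (simp add: sqrt_coeff_def)

text \<open>These are the Taylor coefficients of \<open>(1 - x)^(-1/2)\<close>. They enter twice: up
  to a negative factor they are the later values of \<open>sqrt_coeff\<close>, and they are also its
  partial sums.\<close>

lemma alternating_gbinomial_nonneg: "(-1) ^ n * ((-1/2 :: real) gchoose n) \<ge> 0"
proof -
  have "(-1) ^ n * ((-1/2 :: real) gchoose n) = pochhammer (1/2) n / fact n"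
    by (simp add: gbinomial_pochhammer mult.assoc[symmetric] flip: power_add mult_2)
  then show ?thesis
    by (simp add: pochhammer_nonneg)
qed

lemma sqrt_coeff_Suc_nonpos: "sqrt_coeff (Suc n) \<le> 0"
proof -
  have "sqrt_coeff (Suc n) = - ((1/2) / real (Suc n)) * ((-1) ^ n * ((-1/2) gchoose n))"
    using gbinomial_absorption'[of "Suc n" "1/2::real"] by (simp add: sqrt_coeff_def)
  then show ?thesis
    using alternating_gbinomial_nonneg[of n] by (simp add: mult_nonneg_nonneg)
qed

text \<open>On generating functions, dividing by \<open>1 - x\<close> forms partial sums and turns
  the exponent 1/2 into -1/2.\<close>

lemma sum_sqrt_coeff: "(\<Sum>k\<le>n. sqrt_coeff k) = (-1) ^ n * ((-1/2) gchoose n)"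
  using gbinomial_sum_lower_neg[of "1/2::real" n] by (simp add: sqrt_coeff_def mult.commute)

text \<open>All coefficients after the first are nonpositive, so this sum is 1 minus a partial sum
  of \<open>sqrt_coeff\<close>, and those are nonnegative. The bound yields absolute convergence up
  to and including norm 1.\<close>

lemma sum_abs_sqrt_coeff_Suc_le: "(\<Sum>k<n. \<bar>sqrt_coeff (Suc k)\<bar>) \<le> 1"
proof -
  have "(\<Sum>k\<le>n. sqrt_coeff k) = 1 - (\<Sum>k<n. \<bar>sqrt_coeff (Suc k)\<bar>)"
    by (subst sum.atMost_shift) (simp add: abs_of_nonpos sqrt_coeff_Suc_nonpos sum_negf)
  then show ?thesis
    using alternating_gbinomial_nonneg[of n] by (simp add: sum_sqrt_coeff)
qed

lemma summable_abs_sqrt_coeff_Suc: "summable (\<lambda>k. \<bar>sqrt_coeff (Suc k)\<bar>)"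
  by (rule bounded_imp_summable[where B = 1])
    (use sum_abs_sqrt_coeff_Suc_le[of "Suc _"] in \<open>simp_all add: lessThan_Suc_atMost\<close>)

text \<open>Vandermonde's identity with 1/2 + 1/2 = 1: the right-hand side lists the coefficients of
  \<open>1 - x\<close>.\<close>

lemma sqrt_coeff_convolution:
  "(\<Sum>i\<le>n. sqrt_coeff i * sqrt_coeff (n - i)) = (if n = 0 then 1 else if n = 1 then - 1 else 0)"
proof -
  have "(\<Sum>i\<le>n. sqrt_coeff i * sqrt_coeff (n - i))
      = (-1) ^ n * (\<Sum>i\<le>n. ((1/2) gchoose i) * ((1/2) gchoose (n - i)))"
    unfolding sum_distrib_left
  proof (rule sum.cong)
    fix i assume "i \<in> {..n}"
    then have "(-1 :: real) ^ n = (-1) ^ i * (-1) ^ (n - i)"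
      by (simp flip: power_add)
    then show "sqrt_coeff i * sqrt_coeff (n - i)
        = (-1) ^ n * (((1/2) gchoose i) * ((1/2) gchoose (n - i)))"
      by (simp add: sqrt_coeff_def)
  qed simp
  also have "\<dots> = (-1) ^ n * ((1 :: real) gchoose n)"
    using gbinomial_Vandermonde[of "1/2::real" "1/2" n] by (simp add: atLeast0AtMost)
  also have "(1 :: real) gchoose n = of_nat (1 choose n)"
    by (simp add: binomial_gbinomial)
  finally show ?thesis
    by (auto simp: binomial_eq_0)
qed

section \<open>The binomial series on the closed unit ball of a Banach algebra\<close>

definition sqrt_one_minus :: "'a::{real_normed_algebra_1,banach} \<Rightarrow> 'a" where
  "sqrt_one_minus x = (\<Sum>n. sqrt_coeff n *\<^sub>R x ^ n)"

context
  fixes x :: "'a::{real_normed_algebra_1,banach}"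
  assumes norm_le_1: "norm x \<le> 1"
begin

lemma norm_sqrt_series_Suc_le: "norm (sqrt_coeff (Suc n) *\<^sub>R x ^ Suc n) \<le> \<bar>sqrt_coeff (Suc n)\<bar>"
proof -
  have "norm (x ^ Suc n) \<le> 1"
    by (rule order_trans[OF norm_power_ineq]) (simp add: norm_le_1 power_le_one del: power_Suc)
  then show ?thesis
    by (simp add: mult_left_le del: power_Suc)
qed

lemma summable_norm_sqrt_series: "summable (\<lambda>n. norm (sqrt_coeff n *\<^sub>R x ^ n))"
  by (subst summable_Suc_iff[symmetric],
      rule summable_comparison_test'[OF summable_abs_sqrt_coeff_Suc, of 0])
    (use norm_sqrt_series_Suc_le in simp)

lemma sums_sqrt_one_minus: "(\<lambda>n. sqrt_coeff n *\<^sub>R x ^ n) sums sqrt_one_minus x"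
  unfolding sqrt_one_minus_def
  by (rule summable_sums, rule summable_norm_cancel, rule summable_norm_sqrt_series)

text \<open>The leading term of the series is 1 and the other coefficients have absolute sum at most
  1. This is the norm condition that later makes the root positive, with radius 1.\<close>

lemma norm_one_minus_sqrt_le: "norm (1 - sqrt_one_minus x) \<le> 1"
proof -
  have s: "summable (\<lambda>n. norm (sqrt_coeff (Suc n) *\<^sub>R x ^ Suc n))"
    using summable_norm_sqrt_series by (subst summable_Suc_iff)
  have "sqrt_one_minus x - 1 = (\<Sum>n. sqrt_coeff (Suc n) *\<^sub>R x ^ Suc n)"
    using suminf_split_head[OF sums_summable[OF sums_sqrt_one_minus]]
    by (simp add: sqrt_one_minus_def)
  then have "norm (1 - sqrt_one_minus x) = norm (\<Sum>n. sqrt_coeff (Suc n) *\<^sub>R x ^ Suc n)"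
    by (metis norm_minus_commute)
  also have "\<dots> \<le> (\<Sum>n. norm (sqrt_coeff (Suc n) *\<^sub>R x ^ Suc n))"
    by (rule summable_norm[OF s])
  also have "\<dots> \<le> (\<Sum>n. \<bar>sqrt_coeff (Suc n)\<bar>)"
    by (rule suminf_le[OF norm_sqrt_series_Suc_le s summable_abs_sqrt_coeff_Suc])
  also have "\<dots> \<le> 1"
    by (rule suminf_le_const[OF summable_abs_sqrt_coeff_Suc sum_abs_sqrt_coeff_Suc_le])
  finally show ?thesis .
qed

lemma sqrt_one_minus_square: "sqrt_one_minus x * sqrt_one_minus x = 1 - x"
proof -
  have "(\<lambda>n. \<Sum>i\<le>n. (sqrt_coeff i *\<^sub>R x ^ i) * (sqrt_coeff (n - i) *\<^sub>R x ^ (n - i)))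
      sums (sqrt_one_minus x * sqrt_one_minus x)"
    using Cauchy_product_sums[OF summable_norm_sqrt_series summable_norm_sqrt_series]
    by (simp add: sqrt_one_minus_def)
  moreover have "(\<Sum>i\<le>n. (sqrt_coeff i *\<^sub>R x ^ i) * (sqrt_coeff (n - i) *\<^sub>R x ^ (n - i)))
      = (if n = 0 then 1 else if n = 1 then - 1 else 0) *\<^sub>R x ^ n" for n
  proof -
    have "(\<Sum>i\<le>n. (sqrt_coeff i *\<^sub>R x ^ i) * (sqrt_coeff (n - i) *\<^sub>R x ^ (n - i)))
        = (\<Sum>i\<le>n. (sqrt_coeff i * sqrt_coeff (n - i)) *\<^sub>R x ^ n)"
      by (rule sum.cong) (simp_all flip: power_add)
    then show ?thesis
      by (simp only: sqrt_coeff_convolution flip: scaleR_left.sum)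
  qed
  ultimately have "(\<lambda>n. (if n = 0 then 1 else if n = 1 then - 1 else 0) *\<^sub>R x ^ n)
      sums (sqrt_one_minus x * sqrt_one_minus x)"
    by simp
  moreover have "(\<lambda>n. (if n = 0 then 1 else if n = 1 then - 1 else 0) *\<^sub>R x ^ n)
      sums (\<Sum>n\<in>{0,1}. (if n = 0 then 1 else if n = 1 then - 1 else 0) *\<^sub>R x ^ n)"
    by (rule sums_finite) auto
  ultimately have "sqrt_one_minus x * sqrt_one_minus x
      = (\<Sum>n\<in>{0,1}. (if n = 0 then 1 else if n = 1 then - 1 else 0) *\<^sub>R x ^ n)"
    by (rule sums_unique2)
  then show ?thesis
    by simp
qed

text \<open>Bounded linear maps pass through the series termwise. Commutation, self-adjointness and
  invariance of the root under homomorphisms are all instances.\<close>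

lemma bounded_linear_sqrt_one_minus_eqI:
  assumes "bounded_linear f" "bounded_linear g" "\<And>n. f (x ^ n) = g (x ^ n)"
  shows "f (sqrt_one_minus x) = g (sqrt_one_minus x)"
proof -
  have "(\<lambda>n. f (sqrt_coeff n *\<^sub>R x ^ n)) sums f (sqrt_one_minus x)"
    "(\<lambda>n. g (sqrt_coeff n *\<^sub>R x ^ n)) sums g (sqrt_one_minus x)"
    using assms(1,2) sums_sqrt_one_minus by (auto intro: bounded_linear.sums)
  moreover have "f (sqrt_coeff n *\<^sub>R x ^ n) = g (sqrt_coeff n *\<^sub>R x ^ n)" for n
    using assms by (simp add: linear_simps)
  ultimately show ?thesis
    by (simp add: sums_unique2)
qed

lemma sqrt_one_minus_commute:
  assumes "x * y = y * x"
  shows "sqrt_one_minus x * y = y * sqrt_one_minus x"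
proof (rule bounded_linear_sqrt_one_minus_eqI)
  show "x ^ n * y = y * x ^ n" for n
    using assms by (rule power_commuting_commutes)
qed (rule bounded_linear_mult_left bounded_linear_mult_right)+

end

lemma star_sqrt_one_minus:
  fixes x :: "'a::unital_cstar_algebra"
  assumes "norm x \<le> 1" "star x = x"
  shows "star (sqrt_one_minus x) = sqrt_one_minus x"
  by (rule bounded_linear_sqrt_one_minus_eqI[OF assms(1) bounded_linear_star bounded_linear_ident])
    (simp add: star_power assms(2))

subsection \<open>Positive elements\<close>

text \<open>In spectral terms the norm condition places the spectrum of \<open>h\<close> in the
  interval from 0 to \<open>2 * r\<close>. In this form closure under sums is just the triangle
  inequality.\<close>

definition cstar_pos :: "'a::unital_cstar_algebra \<Rightarrow> bool" where
  "cstar_pos h \<longleftrightarrow> star h = h \<and> (\<exists>r\<ge>0. norm (r *\<^sub>R 1 - h) \<le> r)"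

lemma cstar_pos_add:
  assumes "cstar_pos h" "cstar_pos k"
  shows "cstar_pos (h + k)"
proof -
  obtain r s where r: "r \<ge> 0" "norm (r *\<^sub>R 1 - h) \<le> r" and s: "s \<ge> 0" "norm (s *\<^sub>R 1 - k) \<le> s"
    using assms by (auto simp: cstar_pos_def)
  have "norm ((r + s) *\<^sub>R 1 - (h + k)) \<le> norm (r *\<^sub>R 1 - h) + norm (s *\<^sub>R 1 - k)"
    by (rule order_trans[OF _ norm_triangle_ineq]) (simp add: algebra_simps)
  then have "norm ((r + s) *\<^sub>R 1 - (h + k)) \<le> r + s"
    using r s by linarith
  then show ?thesis
    using assms r s by (auto simp: cstar_pos_def star_add intro!: exI[of _ "r + s"])
qed

lemma cstar_pos_scaleR:
  assumes "cstar_pos h" "t \<ge> 0"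
  shows "cstar_pos (t *\<^sub>R h)"
proof -
  obtain r where r: "r \<ge> 0" "norm (r *\<^sub>R 1 - h) \<le> r"
    using assms by (auto simp: cstar_pos_def)
  have "norm ((t * r) *\<^sub>R 1 - t *\<^sub>R h) = t * norm (r *\<^sub>R 1 - h)"
    using assms(2) by (simp flip: scaleR_scaleR scaleR_diff_right)
  then have "norm ((t * r) *\<^sub>R 1 - t *\<^sub>R h) \<le> t * r"
    using r assms(2) by (simp add: mult_left_mono)
  then show ?thesis
    using assms r by (auto simp: cstar_pos_def star_scaleR intro!: exI[of _ "t * r"])
qed

text \<open>The last two conclusions record what is used of \<open>s\<close> being a norm limit of
  polynomials in \<open>h\<close>.\<close>

lemma cstar_pos_sqrt:
  assumes "cstar_pos h"
  obtains s where "cstar_pos s" "s * s = h" "\<forall>y. h * y = y * h \<longrightarrow> s * y = y * s"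
    "\<forall>f. bounded_linear f \<and> (\<forall>x y. f (x * y) = f x * f y) \<and> f 1 = 1 \<and> f h = h \<longrightarrow> f s = s"
proof -
  obtain r where r: "r \<ge> 0" "norm (r *\<^sub>R 1 - h) \<le> r" and h: "star h = h"
    using assms by (auto simp: cstar_pos_def)
  show thesis
  proof (cases "r = 0")
    case True
    then have "h = 0"
      using r by simp
    then show thesis
      using that[of 0] assms by simp
  next
    case False
    \<comment> \<open>Chosen so that \<open>h\<close> is \<open>r\<close> times \<open>1 - x\<close>
      with \<open>x\<close> in the closed unit ball.\<close>
    define x where "x = 1 - (1 / r) *\<^sub>R h"
    have "x = (1 / r) *\<^sub>R (r *\<^sub>R 1 - h)"
      using False by (simp add: x_def scaleR_diff_right)
    then have nx: "norm x \<le> 1"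
      using r False by (simp add: divide_le_eq)
    have sx: "star x = x"
      by (simp add: x_def star_diff star_scaleR h)
    define s where "s = sqrt r *\<^sub>R sqrt_one_minus x"
    show thesis
    proof (rule that)
      have "cstar_pos (sqrt_one_minus x)"
        using norm_one_minus_sqrt_le[OF nx] star_sqrt_one_minus[OF nx sx]
        by (auto simp: cstar_pos_def intro!: exI[of _ 1])
      then show "cstar_pos s"
        using r by (simp add: s_def cstar_pos_scaleR)
      have "s * s = r *\<^sub>R (1 - x)"
        using r by (simp add: s_def sqrt_one_minus_square[OF nx])
      then show "s * s = h"
        using False by (simp add: x_def)
      show "\<forall>y. h * y = y * h \<longrightarrow> s * y = y * s"
      proof (intro allI impI)
        fix y assume that: "h * y = y * h"
        have "x * y = y * x"
          by (simp add: x_def algebra_simps that)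
        then show "s * y = y * s"
          by (simp add: s_def sqrt_one_minus_commute[OF nx])
      qed
      show "\<forall>f. bounded_linear f \<and> (\<forall>x y. f (x * y) = f x * f y) \<and> f 1 = 1 \<and> f h = h \<longrightarrow> f s = s"
      proof (intro allI impI, elim conjE)
        fix f assume f: "bounded_linear f" "\<forall>x y. f (x * y) = f x * f y" "f 1 = 1" "f h = h"
        have "f x = x"
          by (simp add: x_def linear_simps[OF f(1)] f)
        then have "f (x ^ n) = x ^ n" for n
          by (induction n) (simp_all add: f)
        then have "f (sqrt_one_minus x) = sqrt_one_minus x"
          by (rule bounded_linear_sqrt_one_minus_eqI[OF nx f(1) bounded_linear_ident])
        then show "f s = s"
          by (simp add: s_def linear_simps[OF f(1)])
      qed
    qed
  qed
qed

section \<open>Unitaries, positivity of squares and antisymmetry\<close>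

lemma star_cartesian:
  fixes h k :: "'a::unital_cstar_algebra"
  assumes "star h = h" "star k = k"
  shows "star (h + \<i> *\<^sub>C k) = h - \<i> *\<^sub>C k"
  by (simp add: star_add star_scaleC assms scaleC_minus_left)

lemma mult_cartesian_commuting:
  fixes h k :: "'a::unital_cstar_algebra"
  assumes "h * k = k * h"
  shows "(h - \<i> *\<^sub>C k) * (h + \<i> *\<^sub>C k) = h * h + k * k"
proof -
  have "(- 1) *\<^sub>C (k * k) = - (k * k)"
    by (simp add: scaleC_minus_left scaleC_one)
  then show ?thesis
    by (simp add: algebra_simps scaleC_add_right scaleC_diff_right mult_scaleC_left
        mult_scaleC_right scaleC_scaleC assms)
qed

text \<open>The root of \<open>1 - h * h\<close> serves as \<open>k\<close>; then
  \<open>h + \<i> *\<^sub>C k\<close> is unitary with real part \<open>h\<close>.\<close>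

lemma selfadjoint_contraction_unitary_part:
  fixes h :: "'a::unital_cstar_algebra"
  assumes "star h = h" "norm h \<le> 1"
  obtains k where "star k = k" "h * k = k * h" "h * h + k * k = 1"
proof -
  have n: "norm (h * h) \<le> 1"
    using assms by (simp add: norm_square_selfadjoint power_le_one)
  show thesis
  proof (rule that)
    show "star (sqrt_one_minus (h * h)) = sqrt_one_minus (h * h)"
      using star_sqrt_one_minus[OF n] by (simp add: star_mult assms)
    show "h * sqrt_one_minus (h * h) = sqrt_one_minus (h * h) * h"
      using sqrt_one_minus_commute[OF n, of h] by (simp add: mult.assoc)
    show "h * h + sqrt_one_minus (h * h) * sqrt_one_minus (h * h) = 1"
      by (simp add: sqrt_one_minus_square[OF n])
  qed
qed

text \<open>With \<open>u = h + \<i>k\<close> unitary, \<open>1 - h\<^sup>2 = (2 - u\<^sup>2 - (u\<^sup>*)\<^sup>2) / 4\<close>.\<close>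

lemma norm_one_minus_square_le:
  fixes h :: "'a::unital_cstar_algebra"
  assumes "star h = h" "norm h \<le> 1"
  shows "norm (1 - h * h) \<le> 1"
proof -
  obtain k where k: "star k = k" "h * k = k * h" "h * h + k * k = 1"
    using selfadjoint_contraction_unitary_part[OF assms] .
  define u where "u = h + \<i> *\<^sub>C k"
  have su: "star u = h - \<i> *\<^sub>C k"
    by (simp add: u_def star_cartesian assms k)
  have nu: "norm u = 1"
    by (rule norm_unitary) (unfold su, simp add: u_def mult_cartesian_commuting k)
  have m: "(- 1) *\<^sub>C (k * k) = - (k * k)"
    by (simp add: scaleC_minus_left scaleC_one)
  have "u * u + star u * star u = 2 *\<^sub>R (h * h - k * k)"
    unfolding su unfolding u_def
    by (simp add: algebra_simps scaleC_add_right scaleC_diff_right mult_scaleC_left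
        mult_scaleC_right scaleC_scaleC scaleR_2 m)
  also have "\<dots> = 2 *\<^sub>R 1 - 4 *\<^sub>R (1 - h * h)"
  proof -
    have "k * k = 1 - h * h"
      using k(3) by (simp add: algebra_simps)
    moreover have "4 *\<^sub>R (1 - h * h) = 2 *\<^sub>R (1 - h * h) + 2 *\<^sub>R (1 - h * h)"
      by (simp flip: scaleR_add_left)
    ultimately show ?thesis
      by (simp add: scaleR_2)
  qed
  finally have "4 *\<^sub>R (1 - h * h) = 2 *\<^sub>R 1 - (u * u + star u * star u)"
    by simp
  also have "norm \<dots> \<le> norm (2 *\<^sub>R (1::'a)) + norm (u * u + star u * star u)"
    by (rule norm_triangle_ineq4)
  also have "\<dots> \<le> 2 + (norm (u * u) + norm (star u * star u))"
    using norm_triangle_ineq[of "u * u" "star u * star u"] by simp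
  also have "\<dots> \<le> 2 + (1 + 1)"
    using norm_mult_ineq[of u u] norm_mult_ineq[of "star u" "star u"] nu
    by (intro add_mono) (simp_all add: norm_star)
  finally show ?thesis
    by simp
qed

lemma cstar_pos_square:
  fixes k :: "'a::unital_cstar_algebra"
  assumes "star k = k"
  shows "cstar_pos (k * k)"
proof -
  \<comment> \<open>The summand 1 keeps \<open>t\<close> positive when \<open>k = 0\<close>;
    dividing by \<open>t\<close> makes \<open>k\<close> a contraction.\<close>
  define t where "t = norm k + 1"
  have t: "t > 0"
    unfolding t_def using norm_ge_zero[of k] by linarith
  have "norm ((1 / t) *\<^sub>R k) \<le> 1"
    using t by (simp add: t_def)
  then have "norm (1 - ((1 / t) *\<^sub>R k) * ((1 / t) *\<^sub>R k)) \<le> 1"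
    using assms by (intro norm_one_minus_square_le) (simp_all add: star_scaleR)
  then have "cstar_pos (((1 / t) *\<^sub>R k) * ((1 / t) *\<^sub>R k))"
    using assms by (auto simp: cstar_pos_def star_mult star_scaleR intro!: exI[of _ 1])
  from cstar_pos_scaleR[OF this, of "t * t"] show ?thesis
    using t by simp
qed

text \<open>The roots \<open>s\<close> of \<open>z\<close> and \<open>t\<close> of
  \<open>- z\<close> commute, so \<open>s + \<i> *\<^sub>C t\<close> has modulus squared
  \<open>z - z = 0\<close>. It vanishes together with its adjoint, hence so does
  \<open>s\<close>.\<close>

lemma cstar_pos_antisym:
  assumes "cstar_pos z" "cstar_pos (- z)"
  shows "z = 0"
proof -
  obtain s where s: "cstar_pos s" "s * s = z"
    using cstar_pos_sqrt[OF assms(1)] .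
  obtain t where t: "cstar_pos t" "t * t = - z" "\<forall>y. (- z) * y = y * (- z) \<longrightarrow> t * y = y * t"
    using cstar_pos_sqrt[OF assms(2)] .
  have st: "star s = s" "star t = t"
    using s(1) t(1) by (simp_all add: cstar_pos_def)
  have "z * s = s * z"
    by (simp add: mult.assoc flip: s(2))
  then have "t * s = s * t"
    by (intro t(3)[rule_format]) simp
  then have "(s - \<i> *\<^sub>C t) * (s + \<i> *\<^sub>C t) = 0"
    by (simp add: mult_cartesian_commuting s(2) t(2))
  then have "norm (s + \<i> *\<^sub>C t) = 0"
    using cstar_identity[of "s + \<i> *\<^sub>C t"] by (simp add: star_cartesian st)
  then have a: "s + \<i> *\<^sub>C t = 0"
    by simp
  then have "s - \<i> *\<^sub>C t = 0"
    using star_cartesian[OF st] by simp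
  then have "2 *\<^sub>R s = 0"
    using a by (simp add: scaleR_2)
  then show ?thesis
    using s(2) by simp
qed

text \<open>
  A self-adjoint \<open>y\<close> has norm at most \<open>1\<close> as soon as \<open>norm (y ^ n)\<close> grows at most linearly in \<open>n\<close>.
  Together with the following identity this replaces the equality of the nonzero spectra of
  \<open>c\<^sup>* c\<close> and \<open>c c\<^sup>*\<close>.
\<close>

lemma power_one_plus_mult_swap:
  fixes x y :: "'a::ring_1"
  shows "(1 + x * y) ^ n = 1 + x * (\<Sum>j<n. (1 + y * x) ^ j) * y"
proof (induction n)
  case (Suc n)
  have g: "y * x * (\<Sum>j<n. (1 + y * x) ^ j) = (1 + y * x) ^ n - 1"
    by (induction n) (simp_all add: algebra_simps)
  have "(1 + x * y) ^ Suc n = (1 + x * y) * (1 + x * (\<Sum>j<n. (1 + y * x) ^ j) * y)"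
    by (simp add: Suc)
  also have "\<dots> = 1 + x * (\<Sum>j<n. (1 + y * x) ^ j) * y + x * y
      + x * (y * x * (\<Sum>j<n. (1 + y * x) ^ j)) * y"
    by (simp add: algebra_simps)
  also have "\<dots> = 1 + x * (\<Sum>j<Suc n. (1 + y * x) ^ j) * y"
    unfolding g by (simp add: algebra_simps)
  finally show ?case .
qed simp

text \<open>If \<open>a = 1 + d\<close> with \<open>d > 0\<close>, Bernoulli's inequality at
  \<open>n = 2 ^ k\<close>, squared, bounds \<open>a ^ (2 * n)\<close> below by a quadratic in
  \<open>n\<close>, which exceeds the linear bound once
  \<open>n * d\<^sup>2 > 2 * M\<close>.\<close>

lemma le_1_if_two_powers_linear_bound:
  fixes a M :: real
  assumes "\<And>k. a ^ (2 ^ k) \<le> 1 + 2 ^ k * M" "M \<ge> 0"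
  shows "a \<le> 1"
proof (rule ccontr)
  assume "\<not> a \<le> 1"
  define d where "d = a - 1"
  have d: "d > 0" "a = 1 + d"
    using \<open>\<not> a \<le> 1\<close> by (simp_all add: d_def)
  obtain k where k: "2 * M / d\<^sup>2 < 2 ^ k"
    using real_arch_pow[of 2 "2 * M / d\<^sup>2"] by auto
  define n :: real where "n = 2 ^ k"
  have n: "n > 0" "2 * M < n * d\<^sup>2"
    using k d by (simp_all add: n_def field_simps)
  have "1 + n * d \<le> a ^ (2 ^ k)"
    using Bernoulli_inequality[of d "2 ^ k"] d by (simp add: n_def)
  then have "(1 + n * d) ^ 2 \<le> (a ^ (2 ^ k)) ^ 2"
    using n d by (intro power_mono) simp_all
  also have "\<dots> = a ^ (2 ^ Suc k)"
    by (simp add: mult.commute flip: power_mult)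
  also have "\<dots> \<le> 1 + 2 * n * M"
    using assms(1)[of "Suc k"] by (simp add: n_def)
  finally have "2 * (n * d) + n * (n * d\<^sup>2) \<le> n * (2 * M)"
    by (simp add: power2_eq_square algebra_simps)
  moreover have "n * (2 * M) < n * (n * d\<^sup>2)"
    using n by simp
  moreover have "n * d > 0"
    using n d by simp
  ultimately show False
    by linarith
qed

text \<open>By \<open>power_one_plus_mult_swap\<close>, the \<open>n\<close>-th power of
  \<open>1 + c * star c\<close> is 1 plus \<open>c * S * star c\<close>, where \<open>S\<close> sums
  \<open>n\<close> powers of a contraction; its norm thus grows at most linearly in
  \<open>n\<close>.\<close>

lemma norm_one_plus_star_mult_swap:
  fixes c :: "'a::unital_cstar_algebra"
  assumes "norm (1 + star c * c) \<le> 1"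
  shows "norm (1 + c * star c) \<le> 1"
proof (rule le_1_if_two_powers_linear_bound)
  fix k :: nat
  have "norm (\<Sum>j<n. (1 + star c * c) ^ j) \<le> real n" for n
  proof -
    have "norm (\<Sum>j<n. (1 + star c * c) ^ j) \<le> (\<Sum>j<n. 1)"
      by (rule sum_norm_le, rule order_trans[OF norm_power_ineq])
        (simp add: power_le_one assms)
    then show ?thesis
      by simp
  qed
  from this[of "2 ^ k"] have S: "norm (\<Sum>j<2 ^ k. (1 + star c * c) ^ j) \<le> 2 ^ k"
    by simp
  have "norm (c * (\<Sum>j<2 ^ k. (1 + star c * c) ^ j) * star c)
      \<le> norm (c * (\<Sum>j<2 ^ k. (1 + star c * c) ^ j)) * norm c"
    using norm_mult_ineq[of _ "star c"] by (simp add: norm_star)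
  also have "\<dots> \<le> norm c * 2 ^ k * norm c"
    by (intro mult_right_mono order_trans[OF norm_mult_ineq] mult_left_mono S norm_ge_zero)
  finally have "norm (c * (\<Sum>j<2 ^ k. (1 + star c * c) ^ j) * star c) \<le> norm c * 2 ^ k * norm c" .
  moreover have "norm ((1 + c * star c) ^ 2 ^ k)
      \<le> 1 + norm (c * (\<Sum>j<2 ^ k. (1 + star c * c) ^ j) * star c)"
    by (subst power_one_plus_mult_swap, rule order_trans[OF norm_triangle_ineq]) simp
  moreover have "star (1 + c * star c) = 1 + c * star c"
    by (simp add: star_add star_mult star_star)
  ultimately show "norm (1 + c * star c) ^ 2 ^ k \<le> 1 + 2 ^ k * (norm c * norm c)"
    by (simp add: mult.commute mult.left_commute flip: norm_power_two_power_selfadjoint)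
qed simp

lemma cstar_pos_minus_star_mult_swap:
  assumes "cstar_pos (- (star c * c))"
  shows "cstar_pos (- (c * star c))"
proof -
  obtain r where r: "r \<ge> 0" "norm (r *\<^sub>R 1 + star c * c) \<le> r"
    using assms by (auto simp: cstar_pos_def)
  have sa: "star (- (c * star c)) = - (c * star c)"
    by (simp add: star_minus star_mult star_star)
  show ?thesis
  proof (cases "r = 0")
    case True
    then have "(norm c)\<^sup>2 = 0"
      using r by (simp flip: cstar_identity)
    then show ?thesis
      using sa by (auto simp: cstar_pos_def)
  next
    case False
    \<comment> \<open>This scaling turns the bound with radius \<open>r\<close> into one with radius
      1.\<close>
    define e where "e = (1 / sqrt r) *\<^sub>R c"
    have "star e * e = (1 / r) *\<^sub>R (star c * c)"
      using r by (simp add: e_def star_scaleR)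
    then have "r *\<^sub>R (1 + star e * e) = r *\<^sub>R 1 + star c * c"
      using False by (simp add: scaleR_add_right)
    then have "r * norm (1 + star e * e) \<le> r * 1"
      using r by (metis abs_of_nonneg mult.right_neutral norm_scaleR)
    then have "norm (1 + star e * e) \<le> 1"
      using r False by simp
    then have "norm (1 + e * star e) \<le> 1"
      by (rule norm_one_plus_star_mult_swap)
    moreover have "star (- (e * star e)) = - (e * star e)"
      by (simp add: star_minus star_mult star_star)
    ultimately have "cstar_pos (- (e * star e))"
      by (auto simp: cstar_pos_def intro!: exI[of _ 1])
    moreover have "r *\<^sub>R (- (e * star e)) = - (c * star c)"
      using r False by (simp add: e_def star_scaleR)
    ultimately show ?thesis
      using cstar_pos_scaleR r(1) by metis
  qed
qed

text \<open>
  Writing \<open>c = x + \<i>y\<close> with \<open>x, y\<close> self-adjoint, \<open>c\<^sup>* c + c c\<^sup>* = 2 (x\<^sup>2 + y\<^sup>2)\<close> is positive, while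
  both summands on the left are negative.
\<close>

lemma eq_0_if_star_mult_eq_minus_square:
  fixes c d :: "'a::unital_cstar_algebra"
  assumes "star d = d" "star c * c = - (d * d)"
  shows "d = 0"
proof -
  define x where "x = (1/2) *\<^sub>R (c + star c)"
  define y where "y = (1/2) *\<^sub>R (\<i> *\<^sub>C (star c - c))"
  have sx: "star x = x"
    by (simp add: x_def star_scaleR star_add star_star add.commute)
  have sy: "star y = y"
    by (simp add: y_def star_scaleR star_scaleC star_diff star_star scaleC_minus_left
        flip: scaleC_minus_right)
  have xx: "4 *\<^sub>R (x * x) = (c + star c) * (c + star c)"
    by (simp add: x_def)
  have "4 *\<^sub>R (y * y) = (\<i> *\<^sub>C (star c - c)) * (\<i> *\<^sub>C (star c - c))"
    by (simp add: y_def)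
  also have "\<dots> = - ((star c - c) * (star c - c))"
    by (simp add: mult_scaleC_left mult_scaleC_right scaleC_scaleC scaleC_minus_left scaleC_one)
  finally have yy: "4 *\<^sub>R (y * y) = - ((star c - c) * (star c - c))" .
  have "2 *\<^sub>R (2 *\<^sub>R (x * x + y * y)) = 4 *\<^sub>R (x * x) + 4 *\<^sub>R (y * y)"
    by (simp add: scaleR_add_right)
  also have "\<dots> = 2 *\<^sub>R (star c * c + c * star c)"
    unfolding xx yy by (simp add: algebra_simps scaleR_2)
  finally have "2 *\<^sub>R (x * x + y * y) = star c * c + c * star c"
    by (simp only: scaleR_cancel_left) simp
  \<comment> \<open>Thus \<open>- (d * d)\<close> is a sum of two positive elements, while
    \<open>d * d\<close> is itself positive.\<close>
  then have e: "d * d = c * star c - 2 *\<^sub>R (x * x + y * y)"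
    using assms(2) by (simp add: algebra_simps)
  have "cstar_pos (- (c * star c))"
    using assms by (intro cstar_pos_minus_star_mult_swap) (simp add: cstar_pos_square)
  moreover have "cstar_pos (2 *\<^sub>R (x * x + y * y))"
    using sx sy by (simp add: cstar_pos_scaleR cstar_pos_add cstar_pos_square)
  ultimately have "cstar_pos (- (d * d))"
    using cstar_pos_add[of "- (c * star c)" "2 *\<^sub>R (x * x + y * y)"] by (simp add: e)
  then have "d * d = 0"
    using cstar_pos_antisym cstar_pos_square assms(1) by blast
  then show ?thesis
    using norm_square_selfadjoint[OF assms(1)] by simp
qed

text \<open>
  Kaplansky's argument: for \<open>h = b\<^sup>* b\<close>, \<open>a = \<bar>h\<bar>\<close>, \<open>q = a - h\<close> and \<open>c = b q\<close> one gets
  \<open>c\<^sup>* c = q h q = - q a q = - (\<surd>a q)\<^sup>2\<close>, which forces \<open>q = 0\<close>.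
\<close>

lemma star_mult_sqrt:
  fixes b :: "'a::unital_cstar_algebra"
  obtains s where "star s = s" "s * s = star b * b"
    "\<forall>f. bounded_linear f \<and> (\<forall>x y. f (x * y) = f x * f y) \<and> f 1 = 1 \<and>
      f (star b * b) = star b * b \<longrightarrow> f s = s"
proof -
  define h where "h = star b * b"
  have h: "star h = h"
    by (simp add: h_def star_mult star_star)
  obtain a where a: "cstar_pos a" "a * a = h * h" "\<forall>y. h * h * y = y * (h * h) \<longrightarrow> a * y = y * a"
    "\<forall>f. bounded_linear f \<and> (\<forall>x y. f (x * y) = f x * f y) \<and> f 1 = 1 \<and> f (h * h) = h * h \<longrightarrow> f a = a"
    using cstar_pos_sqrt[OF cstar_pos_square[OF h]] .
  \<comment> \<open>The root \<open>s\<close> has two roles: it exhibits \<open>q * a * q\<close> as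
    a square, and once \<open>a = h\<close> is known it is the root sought.\<close>
  obtain s where s: "cstar_pos s" "s * s = a" "\<forall>y. a * y = y * a \<longrightarrow> s * y = y * s"
    "\<forall>f. bounded_linear f \<and> (\<forall>x y. f (x * y) = f x * f y) \<and> f 1 = 1 \<and> f a = a \<longrightarrow> f s = s"
    using cstar_pos_sqrt[OF a(1)] .
  have st: "star a = a" "star s = s"
    using a(1) s(1) by (simp_all add: cstar_pos_def)
  have ah: "a * h = h * a"
    by (rule a(3)[rule_format]) (simp add: mult.assoc)
  define q where "q = a - h"
  have q: "star q = q"
    by (simp add: q_def star_diff st h)
  have sq: "s * q = q * s"
    by (rule s(3)[rule_format]) (simp add: q_def algebra_simps ah)
  \<comment> \<open>Since \<open>a\<close> and \<open>h\<close> commute and have equal squares,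
    \<open>(a + h) * (a - h) = 0\<close>.\<close>
  have hq: "h * q = - (a * q)"
    by (simp add: q_def algebra_simps ah a(2))
  have "star (b * q) * (b * q) = q * (h * q)"
    by (simp add: star_mult q h_def mult.assoc)
  also have "\<dots> = - ((q * s) * (s * q))"
    by (simp add: hq s(2)[symmetric] mult.assoc)
  finally have "star (b * q) * (b * q) = - ((s * q) * (s * q))"
    by (simp add: sq)
  moreover have "star (s * q) = s * q"
    by (simp add: star_mult st q sq)
  ultimately have "s * q = 0"
    by (intro eq_0_if_star_mult_eq_minus_square)
  then have aq: "a * q = 0"
    by (simp add: s(2)[symmetric] mult.assoc)
  have "q * q = a * q - h * q"
    by (simp add: q_def algebra_simps)
  then have "q = 0"
    using norm_square_selfadjoint[OF q] by (simp add: hq aq)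
  then have "a = h"
    by (simp add: q_def)
  then show thesis
    using that[OF st(2) s(2)[unfolded \<open>a = h\<close> h_def] s(4)[unfolded \<open>a = h\<close> h_def]] by simp
qed

subsection \<open>Even states\<close>

lemma star_automorphism_one:
  assumes "star_automorphism \<theta>"
  shows "\<theta> 1 = 1"
proof -
  obtain u where "\<theta> u = 1"
    using assms by (metis star_automorphism_def bij_pointE)
  moreover have "\<theta> (u * 1) = \<theta> u * \<theta> 1"
    using assms unfolding star_automorphism_def by blast
  ultimately show ?thesis
    by simp
qed

text \<open>
  A self-adjoint contraction is the real part of a unitary, and unitaries are mapped to unitaries.
\<close>

lemma star_automorphism_norm_le:
  fixes x :: "'a::unital_cstar_algebra"
  assumes "star_automorphism \<theta>"
  shows "norm (\<theta> x) \<le> norm x"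
proof -
  have add: "\<theta> (x + y) = \<theta> x + \<theta> y" and scC: "\<theta> (c *\<^sub>C x) = c *\<^sub>C \<theta> x"
    and mult: "\<theta> (x * y) = \<theta> x * \<theta> y" and star: "\<theta> (star x) = star (\<theta> x)" for x y c
    using assms by (auto simp: star_automorphism_def)
  have scR: "\<theta> (r *\<^sub>R x) = r *\<^sub>R \<theta> x" for r x
    using scC[of "complex_of_real r" x] by (simp add: scaleC_of_real)
  have contraction: "norm (\<theta> h) \<le> 1" if h: "star h = h" "norm h \<le> 1" for h
  proof -
    obtain k where k: "star k = k" "h * k = k * h" "h * h + k * k = 1"
      using selfadjoint_contraction_unitary_part[OF h] .
    define u where "u = h + \<i> *\<^sub>C k"
    have su: "star u = h - \<i> *\<^sub>C k"
      by (simp add: u_def star_cartesian h k)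
    have "star u * u = 1"
      unfolding su by (simp add: u_def mult_cartesian_commuting k)
    then have "star (\<theta> u) * \<theta> u = 1"
      by (metis star mult star_automorphism_one[OF assms])
    then have nu: "norm (\<theta> u) = 1"
      by (rule norm_unitary)
    have "u + star u = 2 *\<^sub>R h"
      unfolding su by (simp add: u_def scaleR_2)
    then have "2 *\<^sub>R \<theta> h = \<theta> u + star (\<theta> u)"
      by (metis scR add star)
    then have "2 * norm (\<theta> h) = norm (\<theta> u + star (\<theta> u))"
      by (metis norm_scaleR abs_numeral)
    also have "\<dots> \<le> norm (\<theta> u) + norm (star (\<theta> u))"
      by (rule norm_triangle_ineq)
    finally show ?thesis
      by (simp add: norm_star nu)
  qed
  have selfadjoint: "norm (\<theta> h) \<le> norm h" if h: "star h = h" for h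
  proof (cases "h = 0")
    case True
    then show ?thesis
      using scR[of 0 0] by simp
  next
    case False
    then have "norm (\<theta> ((1 / norm h) *\<^sub>R h)) \<le> 1"
      by (intro contraction) (simp_all add: star_scaleR h)
    then show ?thesis
      using False by (simp add: scR divide_le_eq)
  qed
  \<comment> \<open>The C*-identity reduces the general case to the self-adjoint element
    \<open>star x * x\<close>.\<close>
  have "(norm (\<theta> x))\<^sup>2 = norm (\<theta> (star x * x))"
    by (simp add: mult star cstar_identity)
  also have "\<dots> \<le> norm (star x * x)"
    by (rule selfadjoint) (simp add: star_mult star_star)
  finally show ?thesis
    by (simp add: cstar_identity)
qed

text \<open>\<open>star_automorphism\<close> is purely algebraic; the continuity derived here lets
  \<theta> pass through the series for square roots.\<close>

lemma bounded_linear_star_automorphism: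
  assumes "star_automorphism \<theta>"
  shows "bounded_linear \<theta>"
proof (rule bounded_linear_intro[where K = 1])
  show "\<theta> (x + y) = \<theta> x + \<theta> y" for x y
    using assms by (simp add: star_automorphism_def)
  show "\<theta> (r *\<^sub>R x) = r *\<^sub>R \<theta> x" for r x
    using assms by (simp add: star_automorphism_def flip: scaleC_of_real)
  show "norm (\<theta> x) \<le> norm x * 1" for x
    using star_automorphism_norm_le[OF assms] by simp
qed

section \<open>The conditional expectation onto the even subalgebra\<close>

definition even_part :: "('a::unital_cstar_algebra \<Rightarrow> 'a) \<Rightarrow> 'a \<Rightarrow> 'a" where
  "even_part \<theta> x = (1/2) *\<^sub>R (x + \<theta> x)"

context
  fixes \<theta> :: "'a::unital_cstar_algebra \<Rightarrow> 'a"
  assumes grading: "Z2_grading \<theta>"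
begin

lemma Z2_grading_automorphism: "star_automorphism \<theta>"
  using grading by (simp add: Z2_grading_def)

lemma Z2_grading_simps:
  "\<theta> (x + y) = \<theta> x + \<theta> y" "\<theta> (c *\<^sub>C x) = c *\<^sub>C \<theta> x" "\<theta> (x * y) = \<theta> x * \<theta> y"
  "\<theta> (star x) = star (\<theta> x)" "\<theta> (r *\<^sub>R x) = r *\<^sub>R \<theta> x" "\<theta> (x - y) = \<theta> x - \<theta> y"
  "\<theta> (- x) = - \<theta> x" "\<theta> (\<theta> x) = x" "\<theta> 1 = 1"
  using Z2_grading_automorphism star_automorphism_one[OF Z2_grading_automorphism]
    linear_simps[OF bounded_linear_star_automorphism[OF Z2_grading_automorphism]] grading
  by (auto simp: star_automorphism_def Z2_grading_def fun_eq_iff)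

lemma even_part_even: "even_part \<theta> x \<in> even_subalgebra \<theta>"
  by (simp add: even_part_def even_subalgebra_def Z2_grading_simps add.commute)

lemma even_part_id: "x \<in> even_subalgebra \<theta> \<Longrightarrow> even_part \<theta> x = x"
  by (simp add: even_part_def even_subalgebra_def flip: scaleR_2)

text \<open>For the even part \<open>c\<close> and the odd part \<open>d\<close> of
  \<open>b\<close>, the mixed products are odd and average to 0. Although \<open>d\<close> is odd,
  \<open>star d * d\<close> is fixed by \<theta>, hence so is its root \<open>s\<close>, which
  replaces \<open>d\<close>.\<close>

lemma even_part_star_mult:
  obtains c d where "c \<in> even_subalgebra \<theta>" "d \<in> even_subalgebra \<theta>"
    "even_part \<theta> (star b * b) = star c * c + star d * d"
proof -
  define c where "c = (1/2) *\<^sub>R (b + \<theta> b)"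
  define d where "d = (1/2) *\<^sub>R (b - \<theta> b)"
  have "\<theta> d = - d"
    by (simp add: d_def Z2_grading_simps scaleR_diff_right)
  then have dd: "star (\<theta> d) * \<theta> d = star d * d"
    by (simp add: star_minus)
  obtain s where s: "star s = s" "s * s = star d * d"
    "\<forall>f. bounded_linear f \<and> (\<forall>x y. f (x * y) = f x * f y) \<and> f 1 = 1 \<and>
      f (star d * d) = star d * d \<longrightarrow> f s = s"
    using star_mult_sqrt[of d] .
  have \<theta>s: "\<theta> s = s"
    by (rule s(3)[rule_format])
      (simp add: bounded_linear_star_automorphism[OF Z2_grading_automorphism] Z2_grading_simps dd)
  have "4 *\<^sub>R even_part \<theta> (star b * b) = 4 *\<^sub>R (star c * c + star d * d)"
    by (simp add: even_part_def c_def d_def Z2_grading_simps star_scaleR star_add star_diff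
        algebra_simps scaleR_2)
  then have "even_part \<theta> (star b * b) = star c * c + star s * s"
    by (simp add: s(1,2))
  then show thesis
    using that even_part_even[of b] \<theta>s unfolding c_def even_subalgebra_def even_part_def by blast
qed

text \<open>Linearity and invariance are inherited from \<open>even_part\<close>. Positivity on the
  whole algebra holds because \<open>even_part_star_mult\<close> provides squares of even elements,
  where \<phi> is known to be positive.\<close>

lemma even_extension_even_state:
  assumes "\<phi> \<in> states_on (even_subalgebra \<theta>)"
  shows "\<phi> \<circ> even_part \<theta> \<in> even_states \<theta>"
proof -
  note sub = even_subalgebra_unital_star_subalgebra[OF grading]
  have add: "\<phi> (x + y) = \<phi> x + \<phi> y" if "x \<in> even_subalgebra \<theta>" "y \<in> even_subalgebra \<theta>" for x y
    using assms that by (simp add: states_on_def)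
  have scale: "\<phi> (c *\<^sub>C x) = c * \<phi> x" if "x \<in> even_subalgebra \<theta>" for c x
    using assms that by (simp add: states_on_def)
  have one: "\<phi> 1 = 1"
    using assms by (simp add: states_on_def)
  have pos: "\<phi> (star x * x) \<in> \<real>\<^sub>\<ge>\<^sub>0" if "x \<in> even_subalgebra \<theta>" for x
    using assms that by (simp add: states_on_def)
  have "even_part \<theta> (x + y) = even_part \<theta> x + even_part \<theta> y" for x y
    by (simp add: even_part_def Z2_grading_simps algebra_simps)
  moreover have "even_part \<theta> (c *\<^sub>C x) = c *\<^sub>C even_part \<theta> x" for c x
    by (simp add: even_part_def Z2_grading_simps scaleC_scaleC mult.commute
        flip: scaleC_add_right scaleC_of_real)
  moreover have "\<phi> (even_part \<theta> (star b * b)) \<in> \<real>\<^sub>\<ge>\<^sub>0" for b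
  proof -
    obtain c d where "c \<in> even_subalgebra \<theta>" "d \<in> even_subalgebra \<theta>"
      "even_part \<theta> (star b * b) = star c * c + star d * d"
      using even_part_star_mult .
    then show ?thesis
      by (simp add: add pos sub nonneg_Reals_add_I)
  qed
  moreover have "even_part \<theta> (\<theta> x) = even_part \<theta> x" for x
    by (simp add: even_part_def Z2_grading_simps add.commute)
  ultimately show ?thesis
    by (simp add: even_states_def states_on_def fun_eq_iff add scale one even_part_even
        even_part_id sub(1))
qed

text \<open>Invariance makes both terms of the average equal; equivalently, an even state vanishes
  on odd elements.\<close>

lemma even_state_even_part:
  assumes "\<omega> \<in> even_states \<theta>"
  shows "\<omega> (even_part \<theta> x) = \<omega> x"
proof -
  have "\<omega> (\<theta> x) = \<omega> x"
    using assms by (simp add: even_states_def fun_eq_iff)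
  then have "\<omega> (even_part \<theta> x) = complex_of_real (1/2) * (\<omega> x + \<omega> x)"
    using assms
    by (simp add: even_states_def states_on_def even_part_def del: of_real_divide
        flip: scaleC_of_real)
  then show ?thesis
    by simp
qed

lemma restrict_even_state:
  "\<omega> \<in> even_states \<theta> \<Longrightarrow>
    restrict_functional \<omega> (even_subalgebra \<theta>) \<in> states_on (even_subalgebra \<theta>)"
  using even_subalgebra_unital_star_subalgebra[OF grading]
  by (auto simp: even_states_def states_on_def restrict_functional_def)

text \<open>Equality holds as functions on the whole type because members of
  \<open>states_on\<close> vanish outside the subalgebra.\<close>

lemma restrict_even_extension:
  assumes "\<phi> \<in> states_on (even_subalgebra \<theta>)"
  shows "restrict_functional (\<phi> \<circ> even_part \<theta>) (even_subalgebra \<theta>) = \<phi>"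
  using assms by (auto simp: restrict_functional_def states_on_def even_part_id)

lemma even_extension_restrict:
  assumes "\<omega> \<in> even_states \<theta>"
  shows "restrict_functional \<omega> (even_subalgebra \<theta>) \<circ> even_part \<theta> = \<omega>"
  using even_state_even_part[OF assms] by (auto simp: restrict_functional_def even_part_even)

end

section \<open>Transport of extreme points along the affine bijection\<close>

theorem proposition2p4:
  fixes \<theta> :: "'a::unital_cstar_algebra \<Rightarrow> 'a"
    and \<omega> :: "'a \<Rightarrow> complex"
  assumes "Z2_grading \<theta>"
    and "\<omega> \<in> even_states \<theta>"
  shows "\<omega> extreme_point_of even_states \<theta> \<longleftrightarrow>
    pure_state_on (even_subalgebra \<theta>) (restrict_functional \<omega> (even_subalgebra \<theta>))"
proof -
  define R where "R = (\<lambda>\<psi>::'a \<Rightarrow> complex. restrict_functional \<psi> (even_subalgebra \<theta>))"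
  define X where "X = (\<lambda>\<phi>::'a \<Rightarrow> complex. \<phi> \<circ> even_part \<theta>)"
  have R_lin: "R ((1 - u) *\<^sub>R f + u *\<^sub>R g) = (1 - u) *\<^sub>R R f + u *\<^sub>R R g" for u f g
    by (auto simp: R_def restrict_functional_def scaleR_fun_def)
  have X_lin: "X ((1 - u) *\<^sub>R f + u *\<^sub>R g) = (1 - u) *\<^sub>R X f + u *\<^sub>R X g" for u f g
    by (auto simp: X_def scaleR_fun_def)
  have R: "R \<psi> \<in> states_on (even_subalgebra \<theta>)" "X (R \<psi>) = \<psi>" if "\<psi> \<in> even_states \<theta>" for \<psi>
    using that by (simp_all add: R_def X_def restrict_even_state even_extension_restrict assms(1))
  have X: "X \<phi> \<in> even_states \<theta>" "R (X \<phi>) = \<phi>" if "\<phi> \<in> states_on (even_subalgebra \<theta>)" for \<phi>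
    using that by (simp_all add: R_def X_def even_extension_even_state restrict_even_extension assms(1))
  have "\<omega> extreme_point_of even_states \<theta> \<longleftrightarrow> R \<omega> extreme_point_of states_on (even_subalgebra \<theta>)"
    unfolding extreme_point_of_def
  proof (intro iffI conjI ballI)
    assume ext: "\<omega> \<in> even_states \<theta> \<and>
      (\<forall>f\<in>even_states \<theta>. \<forall>g\<in>even_states \<theta>. \<omega> \<notin> open_segment f g)"
    fix f g assume fg: "f \<in> states_on (even_subalgebra \<theta>)" "g \<in> states_on (even_subalgebra \<theta>)"
    show "R \<omega> \<notin> open_segment f g"
    proof
      assume "R \<omega> \<in> open_segment f g"
      \<comment> \<open>An open segment requires distinct endpoints; \<open>X f\<close> and
        \<open>X g\<close> differ because \<open>R\<close> is a left inverse of \<open>X\<close> on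
        states of the even subalgebra.\<close>
      then have "\<omega> \<in> open_segment (X f) (X g)"
        using R(2)[OF assms(2)] X(2) fg X_lin unfolding in_segment by metis
      then show False
        using ext fg X(1) by blast
    qed
  next
    assume ext: "R \<omega> \<in> states_on (even_subalgebra \<theta>) \<and>
      (\<forall>f\<in>states_on (even_subalgebra \<theta>). \<forall>g\<in>states_on (even_subalgebra \<theta>).
        R \<omega> \<notin> open_segment f g)"
    fix f g assume fg: "f \<in> even_states \<theta>" "g \<in> even_states \<theta>"
    show "\<omega> \<notin> open_segment f g"
    proof
      assume "\<omega> \<in> open_segment f g"
      then have "R \<omega> \<in> open_segment (R f) (R g)"
        using R(2) fg R_lin unfolding in_segment by metis
      then show False
        using ext fg R(1) by blast
    qed
  qed (simp_all add: assms(2) R(1))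
  then show ?thesis
    by (simp add: pure_state_on_def R_def)
qed

end
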